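(* Let $W,\lambda,T_C,E_C,D>0$ and let $n\ge 1$ be an integer. Consider minimizing $$\sum_{i=1}^n\left[(w_is_i^2+E_C)+\lambda\left(\frac{w_i}{s_i}+T_C\right)(w_i\sigma_i^2+E_C)\right]$$ over $w_i>0$ with $\sum_iw_i=W$, $s_i>0$, $\sigma_i>0$, subject to $$\sum_{i=1}^n\left[\left(\frac{w_i}{s_i}+T_C\right)+\lambda\left(\frac{w_i}{s_i}+T_C\right)\left(\frac{w_i}{\sigma_i}+T_C\right)\right]\le D.$$ In any optimal solution, all chunks have the same size $w_i=W/n$ and all execution speeds $s_i$ are equal.
   Context: This is the divisible-workload, multiple-speed model with an expected deadline. Chunk $i$ of size $w_i$ is executed at speed $s_i$ and, in case of failure, re-executed once at speed $\sigma_i$. $\lambda$ is the failure rate, $T_C$ the checkpoint time, and $E_C$ the checkpoint energy. *)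

theory Defs
  imports Complex_Main
begin

text \<open>
  A solution is a triple (w, s, sg) of chunk sizes, execution speeds and re-execution speeds;
  only the values at the indices 1, ..., n matter. To first order in the failure rate lam, an
  execution of length t fails with probability lam * t, and a re-execution always succeeds; the
  expectations below are taken in this model.
\<close>

type_synonym solution = "(nat \<Rightarrow> real) \<times> (nat \<Rightarrow> real) \<times> (nat \<Rightarrow> real)"

definition exec_time :: "real \<Rightarrow> real \<Rightarrow> real \<Rightarrow> real" where
  "exec_time TC w s = w / s + TC"

definition exec_energy :: "real \<Rightarrow> real \<Rightarrow> real \<Rightarrow> real" where
  "exec_energy EC w s = w * s\<^sup>2 + EC"

definition expected_energy :: "real \<Rightarrow> real \<Rightarrow> real \<Rightarrow> nat \<Rightarrow> solution \<Rightarrow> real" where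
  "expected_energy lam TC EC n = (\<lambda>(w, s, sg).
     \<Sum>i = 1..n. exec_energy EC (w i) (s i)
                  + lam * exec_time TC (w i) (s i) * exec_energy EC (w i) (sg i))"

definition expected_time :: "real \<Rightarrow> real \<Rightarrow> nat \<Rightarrow> solution \<Rightarrow> real" where
  "expected_time lam TC n = (\<lambda>(w, s, sg).
     \<Sum>i = 1..n. exec_time TC (w i) (s i)
                  + lam * exec_time TC (w i) (s i) * exec_time TC (w i) (sg i))"

definition feasible :: "real \<Rightarrow> real \<Rightarrow> real \<Rightarrow> real \<Rightarrow> nat \<Rightarrow> solution \<Rightarrow> bool" where
  "feasible W lam TC D n = (\<lambda>(w, s, sg).
     (\<forall>i\<in>{1..n}. 0 < w i \<and> 0 < s i \<and> 0 < sg i)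
     \<and> (\<Sum>i = 1..n. w i) = W
     \<and> expected_time lam TC n (w, s, sg) \<le> D)"

definition optimal :: "real \<Rightarrow> real \<Rightarrow> real \<Rightarrow> real \<Rightarrow> real \<Rightarrow> nat \<Rightarrow> solution \<Rightarrow> bool" where
  "optimal W lam TC EC D n = is_arg_min (expected_energy lam TC EC n) (feasible W lam TC D n)"

end

theory Submission imports Defs begin

text \<open>
  In the coordinates \<open>w\<close>, \<open>x = w / s\<close>, \<open>y = w / sg\<close> the expected time of a chunk does not
  involve \<open>w\<close> and is affine in each of \<open>x\<close> and \<open>y\<close>. Hence two chunks of an optimal solution may be
  moved along straight lines that keep the total size and the expected time constant, and the
  energy is stationary along them. Exchanging \<open>y\<close> shows that the re-execution speeds agree,
  \<open>sg i = sg j = r\<close>; exchanging \<open>x\<close> of one chunk against \<open>y\<close> of the other gives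
  \<open>2 s^3 = A + 3 lam r^2 w\<close> for both chunks with a common \<open>A > 0\<close>; exchanging \<open>w\<close> shows that
  \<open>s^2 + lam r^2 w / s\<close> agrees. Eliminating \<open>w\<close>, the function \<open>5 s^2 - A / s\<close> agrees, and it is
  strictly increasing in \<open>s\<close>.
\<close>

text \<open>With \<open>x = p / s\<close> and \<open>y = p / sg\<close>, the terms
  \<open>p * s^2\<close> and \<open>p * sg^2\<close> turn into \<open>p^3 / x^2\<close> and
  \<open>p^3 / y^2\<close>.\<close>

definition chunk_energy :: "real \<Rightarrow> real \<Rightarrow> real \<Rightarrow> real \<Rightarrow> real \<Rightarrow> real \<Rightarrow> real" where
  "chunk_energy lam TC EC p x y = p^3 / x\<^sup>2 + EC + lam * (x + TC) * (p^3 / y\<^sup>2 + EC)"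

definition chunk_time :: "real \<Rightarrow> real \<Rightarrow> real \<Rightarrow> real \<Rightarrow> real" where
  "chunk_time lam TC x y = (x + TC) + lam * (x + TC) * (y + TC)"

lemma expected_energy_chunks:
  assumes "feasible W lam TC D n (w, s, sg)"
  shows "expected_energy lam TC EC n (w, s, sg)
         = (\<Sum>i = 1..n. chunk_energy lam TC EC (w i) (w i / s i) (w i / sg i))"
  using assms unfolding feasible_def expected_energy_def chunk_energy_def
    exec_energy_def exec_time_def
  by (auto intro!: sum.cong simp: power2_eq_square power3_eq_cube)

lemma expected_time_chunks:
  "expected_time lam TC n (w, s, sg) = (\<Sum>i = 1..n. chunk_time lam TC (w i / s i) (w i / sg i))"
  unfolding expected_time_def chunk_time_def exec_time_def by simp

lemma sum_remove2:
  fixes f :: "'a \<Rightarrow> 'b::comm_monoid_add"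
  assumes "finite S" "i \<in> S" "j \<in> S" "i \<noteq> j"
  shows "sum f S = f i + f j + sum f (S - {i, j})"
proof -
  have "sum f S = sum f {i, j} + sum f (S - {i, j})"
    using assms sum.subset_diff[of "{i, j}" S f] by (simp add: add.commute)
  then show ?thesis using assms by simp
qed

text \<open>The other chunks contribute equally to both solutions, so optimality passes to the pair.
  The speeds of the competitor are recovered as size over duration.\<close>

lemma optimal_exchange:
  assumes opt: "optimal W lam TC EC D n (w, s, sg)"
    and ij: "i \<in> {1..n}" "j \<in> {1..n}" "i \<noteq> j"
    and pos: "0 < p" "0 < x" "0 < y" "0 < p'" "0 < x'" "0 < y'"
    and size: "p + p' = w i + w j"
    and time: "chunk_time lam TC x y + chunk_time lam TC x' y'
      = chunk_time lam TC (w i / s i) (w i / sg i) + chunk_time lam TC (w j / s j) (w j / sg j)"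
  shows "chunk_energy lam TC EC (w i) (w i / s i) (w i / sg i)
       + chunk_energy lam TC EC (w j) (w j / s j) (w j / sg j)
       \<le> chunk_energy lam TC EC p x y + chunk_energy lam TC EC p' x' y'"
proof -
  define w' where "w' = w(i := p, j := p')"
  define s' where "s' = s(i := p / x, j := p' / x')"
  define sg' where "sg' = sg(i := p / y, j := p' / y')"
  have feas: "feasible W lam TC D n (w, s, sg)"
    using opt by (simp add: optimal_def is_arg_min_def)
  note rem = sum_remove2[OF finite_atLeastAtMost ij]
  have sum_w: "(\<Sum>i = 1..n. w' i) = (\<Sum>i = 1..n. w i)"
    using ij size unfolding rem by (simp add: w'_def)
  have "expected_time lam TC n (w', s', sg') = expected_time lam TC n (w, s, sg)"
    using ij pos time unfolding expected_time_chunks rem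
    by (simp add: w'_def s'_def sg'_def)
  then have feas': "feasible W lam TC D n (w', s', sg')"
    using feas ij pos sum_w unfolding feasible_def
    by (simp add: w'_def s'_def sg'_def)
  have "expected_energy lam TC EC n (w, s, sg) \<le> expected_energy lam TC EC n (w', s', sg')"
    using opt feas' by (force simp: optimal_def is_arg_min_def not_less)
  then show ?thesis
    using ij pos unfolding expected_energy_chunks[OF feas] expected_energy_chunks[OF feas'] rem
    by (simp add: w'_def s'_def sg'_def)
qed

text \<open>A line in size and duration through a point of speed \<open>v\<close>: expressed in
  \<open>v\<close>, the quotient rule leaves neither \<open>p\<close> nor the duration.\<close>

lemma cube_over_square_line_deriv:
  fixes p v a d :: real
  assumes "0 < p" "0 < v"
  shows "((\<lambda>t. (p + a * t)^3 / (p / v + d * t)\<^sup>2) has_real_derivative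
     3 * a * v\<^sup>2 - 2 * d * v^3) (at 0)"
proof -
  have x: "p / v + d * 0 \<noteq> 0" using assms by simp
  have num: "((\<lambda>t. (p + a * t)^3) has_real_derivative 3 * p\<^sup>2 * a) (at 0)"
    by (auto intro!: derivative_eq_intros)
  have den: "((\<lambda>t. (p / v + d * t)\<^sup>2) has_real_derivative 2 * (p / v) * d) (at 0)"
    by (auto intro!: derivative_eq_intros)
  have "(3 * p\<^sup>2 * a * (p / v)\<^sup>2 - p^3 * (2 * (p / v) * d)) / ((p / v)\<^sup>2 * (p / v)\<^sup>2)
      = 3 * a * v\<^sup>2 - 2 * d * v^3"
    using assms by (simp add: field_simps power2_eq_square power3_eq_cube)
  then show ?thesis
    using DERIV_divide[OF num den] x by (simp del: power_divide add: power2_eq_square)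
qed

lemma chunk_energy_line_deriv:
  assumes "0 < p" "0 < s" "0 < r"
  shows "((\<lambda>t. chunk_energy lam TC EC (p + a * t) (p / s + b * t) (p / r + c * t))
     has_real_derivative
       3 * a * (s\<^sup>2 + lam * (p / s + TC) * r\<^sup>2) + b * (lam * (p * r\<^sup>2 + EC) - 2 * s^3)
       - 2 * lam * c * (p / s + TC) * r^3) (at 0)"
proof -
  have cube: "p^3 / (p / r)\<^sup>2 = p * r\<^sup>2"
    using assms by (simp add: power2_eq_square power3_eq_cube)
  have time: "((\<lambda>t. lam * (p / s + b * t + TC)) has_real_derivative lam * b) (at 0)"
    by (auto intro!: derivative_eq_intros)
  have fst: "((\<lambda>t. (p + a * t)^3 / (p / s + b * t)\<^sup>2 + EC) has_real_derivative
      3 * a * s\<^sup>2 - 2 * b * s^3) (at 0)"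
    using DERIV_add[OF cube_over_square_line_deriv[OF assms(1,2)] DERIV_const] by simp
  have snd: "((\<lambda>t. (p + a * t)^3 / (p / r + c * t)\<^sup>2 + EC) has_real_derivative
      3 * a * r\<^sup>2 - 2 * c * r^3) (at 0)"
    using DERIV_add[OF cube_over_square_line_deriv[OF assms(1,3)] DERIV_const] by simp
  show ?thesis
    unfolding chunk_energy_def
    by (rule DERIV_cong[OF DERIV_add[OF fst DERIV_mult[OF time snd]]])
      (simp add: cube algebra_simps del: power_divide)
qed

text \<open>The expansion is exact, the time being a product of an affine function of
  \<open>x\<close> and one of \<open>y\<close>.\<close>

lemma chunk_time_line:
  "chunk_time lam TC (x + b * t) (y + c * t) = chunk_time lam TC x y
     + t * (b * (1 + lam * (y + TC)) + lam * c * (x + TC)) + lam * t\<^sup>2 * (b * c)"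
  unfolding chunk_time_def by (simp add: algebra_simps power2_eq_square)

text \<open>The conditions \<open>b * c = 0\<close> remove the quadratic term of the expected time along the line.\<close>

lemma optimal_stationary:
  assumes opt: "optimal W lam TC EC D n (w, s, sg)"
    and ij: "i \<in> {1..n}" "j \<in> {1..n}" "i \<noteq> j"
    and bc: "b * c = 0" "b' * c' = 0"
    and time: "b * (1 + lam * (w i / sg i + TC)) + lam * c * (w i / s i + TC)
      + b' * (1 + lam * (w j / sg j + TC)) + lam * c' * (w j / s j + TC) = 0"
  shows "3 * a * (s i ^ 2 + lam * (w i / s i + TC) * sg i ^ 2)
       + b * (lam * (w i * sg i ^ 2 + EC) - 2 * s i ^ 3) - 2 * lam * c * (w i / s i + TC) * sg i ^ 3
     + (- 3 * a * (s j ^ 2 + lam * (w j / s j + TC) * sg j ^ 2)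
       + b' * (lam * (w j * sg j ^ 2 + EC) - 2 * s j ^ 3) - 2 * lam * c' * (w j / s j + TC) * sg j ^ 3)
     = 0" (is "?Di + ?Dj = 0")
proof -
  have pos: "0 < w i" "0 < s i" "0 < sg i" "0 < w j" "0 < s j" "0 < sg j"
    using opt ij by (auto simp: optimal_def is_arg_min_def feasible_def)
  let ?f = "\<lambda>t. chunk_energy lam TC EC (w i + a * t) (w i / s i + b * t) (w i / sg i + c * t)
    + chunk_energy lam TC EC (w j + (- a) * t) (w j / s j + b' * t) (w j / sg j + c' * t)"
  have "(?f has_real_derivative ?Di + ?Dj) (at 0)"
    using DERIV_add[OF chunk_energy_line_deriv[OF pos(1-3)] chunk_energy_line_deriv[OF pos(4-6)]]
    by (rule DERIV_cong) simp
  \<comment> \<open>Positivity is an open condition, so all small \<open>t\<close> of either sign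
    give admissible pairs and \<open>t = 0\<close> is an interior local minimum.\<close>
  moreover obtain d where "0 < d" and "\<forall>t. \<bar>0 - t\<bar> < d \<longrightarrow> ?f 0 \<le> ?f t"
  proof -
    have ev: "eventually (\<lambda>t. 0 < u + v * t) (nhds 0)" if "0 < u" for u v :: real
      by (rule order_tendstoD(1)[OF _ that])
        (auto intro!: tendsto_eq_intros filterlim_ident)
    have "eventually (\<lambda>t. 0 < w i + a * t \<and> 0 < w i / s i + b * t \<and> 0 < w i / sg i + c * t
      \<and> 0 < w j + (- a) * t \<and> 0 < w j / s j + b' * t \<and> 0 < w j / sg j + c' * t) (nhds 0)"
      using pos by (intro eventually_conj ev) auto
    then have "eventually (\<lambda>t. ?f 0 \<le> ?f t) (nhds 0)"
    proof eventually_elim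
      case (elim t)
      have "chunk_time lam TC (w i / s i + b * t) (w i / sg i + c * t)
          + chunk_time lam TC (w j / s j + b' * t) (w j / sg j + c' * t)
          - (chunk_time lam TC (w i / s i) (w i / sg i)
             + chunk_time lam TC (w j / s j) (w j / sg j))
          = t * (b * (1 + lam * (w i / sg i + TC)) + lam * c * (w i / s i + TC)
              + b' * (1 + lam * (w j / sg j + TC)) + lam * c' * (w j / s j + TC))"
        unfolding chunk_time_line bc by (simp add: distrib_left)
      also have "\<dots> = 0" unfolding time by simp
      finally show ?case
        using optimal_exchange[OF opt ij, of "w i + a * t" "w i / s i + b * t" "w i / sg i + c * t"
            "w j + (- a) * t" "w j / s j + b' * t" "w j / sg j + c' * t"] elim by simp
    qed
    then obtain d where "0 < d" "\<forall>t. dist t 0 < d \<longrightarrow> ?f 0 \<le> ?f t"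
      unfolding eventually_nhds_metric by blast
    then show ?thesis by (intro that[of d]) (simp_all add: dist_real_def)
  qed
  ultimately show ?thesis by (rule DERIV_local_min)
qed

lemma optimal_respeed_eq:
  assumes opt: "optimal W lam TC EC D n (w, s, sg)" and "lam > 0" "TC > 0"
    and ij: "i \<in> {1..n}" "j \<in> {1..n}" "i \<noteq> j"
  shows "sg i = sg j"
proof -
  have pos: "0 < w i" "0 < s i" "0 < sg i" "0 < w j" "0 < s j" "0 < sg j"
    using opt ij by (auto simp: optimal_def is_arg_min_def feasible_def)
  define X Y where "X = w i / s i + TC" and "Y = w j / s j + TC"
  have XY: "0 < X" "0 < Y" using pos \<open>TC > 0\<close> by (simp_all add: X_def Y_def add_pos_pos)
  \<comment> \<open>Weighting the two changes of re-execution time by \<open>Y\<close> and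
    \<open>- X\<close> balances the expected time.\<close>
  have "2 * lam * X * Y * (sg j ^ 3 - sg i ^ 3) = 0"
    using optimal_stationary[OF opt ij, of 0 Y 0 "- X" 0, folded X_def Y_def]
    by (simp add: algebra_simps)
  then have "sg j ^ 3 = sg i ^ 3" using XY \<open>lam > 0\<close> by simp
  then show ?thesis using pos by (metis less_imp_le power_eq_imp_eq_base zero_less_numeral)
qed

text \<open>Chunk \<open>j\<close> is only an exchange partner: once its re-execution speed is
  replaced by that of \<open>i\<close>, the factor \<open>lam * Y\<close> cancels and a relation for
  chunk \<open>i\<close> alone remains.\<close>

lemma optimal_speed_cube:
  assumes opt: "optimal W lam TC EC D n (w, s, sg)" and "lam > 0" "TC > 0"
    and ij: "i \<in> {1..n}" "j \<in> {1..n}" "i \<noteq> j"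
  shows "2 * s i ^ 3 = lam * EC + 2 * sg i ^ 3 * (1 + lam * TC) + 3 * lam * sg i ^ 2 * w i"
proof -
  have pos: "0 < w i" "0 < s i" "0 < sg i" "0 < w j" "0 < s j" "0 < sg j"
    using opt ij by (auto simp: optimal_def is_arg_min_def feasible_def)
  define Y where "Y = w j / s j + TC"
  define q where "q = 1 + lam * (w i / sg i + TC)"
  have Y: "0 < Y" using pos \<open>TC > 0\<close> by (simp add: Y_def add_pos_pos)
  \<comment> \<open>Trading the execution time of \<open>i\<close> for the re-execution time of the
    other chunk keeps both products \<open>b * c\<close> and \<open>b' * c'\<close> zero; a trade
    inside one chunk would not.\<close>
  have "lam * Y * (lam * (w i * sg i ^ 2 + EC) - 2 * s i ^ 3 + 2 * q * sg j ^ 3) = 0"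
    using optimal_stationary[OF opt ij, of "lam * Y" 0 0 "- q" 0, folded Y_def q_def]
    by (simp add: algebra_simps)
  then have "lam * (w i * sg i ^ 2 + EC) - 2 * s i ^ 3 + 2 * q * sg i ^ 3 = 0"
    using Y \<open>lam > 0\<close> optimal_respeed_eq[OF assms] by simp
  \<comment> \<open>Writing \<open>w i = v * sg i\<close> clears the division in \<open>q\<close>;
    the part \<open>2 * lam * v * sg i ^ 3\<close> then raises the coefficient of
    \<open>lam * sg i ^ 2 * w i\<close> from 1 to 3.\<close>
  moreover define v where "v = w i / sg i"
  have q: "q = 1 + lam * (v + TC)" and w: "w i = v * sg i" using pos by (simp_all add: q_def v_def)
  ultimately show ?thesis
    unfolding q w by (simp add: algebra_simps power2_eq_square power3_eq_cube)
qed

text \<open>Size moves while all durations stay fixed, so the expected time is unchanged. The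
  \<open>TC\<close> terms cancel because the re-execution speeds agree.\<close>

lemma optimal_size_balance:
  assumes opt: "optimal W lam TC EC D n (w, s, sg)" and "lam > 0" "TC > 0"
    and ij: "i \<in> {1..n}" "j \<in> {1..n}" "i \<noteq> j"
  shows "s i ^ 2 + lam * sg i ^ 2 * w i / s i = s j ^ 2 + lam * sg i ^ 2 * w j / s j"
proof -
  have "3 * (s i ^ 2 + lam * sg i ^ 2 * w i / s i) = 3 * (s j ^ 2 + lam * sg i ^ 2 * w j / s j)"
    using optimal_stationary[OF opt ij, of 0 0 0 0 1] optimal_respeed_eq[OF assms]
    by (simp add: algebra_simps)
  then show ?thesis by simp
qed

lemma strict_mono_square_minus_inverse:
  fixes A u v :: real
  assumes "0 < A" "0 < u" "u < v"
  shows "5 * u\<^sup>2 - A / u < 5 * v\<^sup>2 - A / v"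
proof -
  have "u\<^sup>2 < v\<^sup>2" using assms by (intro power_strict_mono) auto
  moreover have "A / v < A / u" using assms by (intro divide_strict_left_mono) auto
  ultimately show ?thesis by linarith
qed

lemma optimal_pair_eq:
  assumes opt: "optimal W lam TC EC D n (w, s, sg)" and "lam > 0" "TC > 0" "EC > 0"
    and ij: "i \<in> {1..n}" "j \<in> {1..n}" "i \<noteq> j"
  shows "s i = s j" "w i = w j"
proof -
  have pos: "0 < w i" "0 < s i" "0 < sg i" "0 < w j" "0 < s j" "0 < sg j"
    using opt ij by (auto simp: optimal_def is_arg_min_def feasible_def)
  define A where "A = lam * EC + 2 * sg i ^ 3 * (1 + lam * TC)"
  have A: "0 < A" unfolding A_def using \<open>lam > 0\<close> \<open>TC > 0\<close> \<open>EC > 0\<close> pos(3)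
    by (intro add_pos_pos mult_pos_pos) auto
  have sg: "sg j = sg i" by (rule optimal_respeed_eq[OF opt assms(2,3) ij, symmetric])
  have ci: "2 * s i ^ 3 = A + 3 * lam * sg i ^ 2 * w i"
    unfolding A_def by (rule optimal_speed_cube[OF opt assms(2,3) ij])
  have cj: "2 * s j ^ 3 = A + 3 * lam * sg i ^ 2 * w j"
    unfolding A_def
    by (rule optimal_speed_cube[OF opt assms(2,3) ij(2,1) ij(3)[symmetric], unfolded sg])
  \<comment> \<open>The cubic relation divided by \<open>u\<close> replaces the term in
    \<open>p\<close> by \<open>2 * u^2 - A / u\<close>.\<close>
  have elim: "3 * (u\<^sup>2 + lam * sg i ^ 2 * p / u) = 5 * u\<^sup>2 - A / u"
    if "0 < u" "2 * u ^ 3 = A + 3 * lam * sg i ^ 2 * p" for u p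
  proof -
    have "A = 2 * u ^ 3 - 3 * (lam * sg i ^ 2 * p)" using that(2) by linarith
    moreover have "u ^ 3 / u = u\<^sup>2" using that(1) by (simp add: power2_eq_square power3_eq_cube)
    ultimately show ?thesis by (simp add: diff_divide_distrib)
  qed
  have "5 * (s i)\<^sup>2 - A / s i = 5 * (s j)\<^sup>2 - A / s j"
    unfolding elim[OF pos(2) ci, symmetric] elim[OF pos(5) cj, symmetric]
    by (rule arg_cong[OF optimal_size_balance[OF opt assms(2,3) ij]])
  then show s: "s i = s j"
    using strict_mono_square_minus_inverse[OF A pos(2), of "s j"]
      strict_mono_square_minus_inverse[OF A pos(5), of "s i"]
    by (metis less_irrefl linorder_less_linear)
  \<comment> \<open>At equal speeds the cubic relation is linear in the size and determines
    it.\<close>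
  have "3 * lam * sg i ^ 2 * w i = 3 * lam * sg i ^ 2 * w j" using ci cj unfolding s by linarith
  then show "w i = w j" using pos(3) \<open>lam > 0\<close> by simp
qed

theorem theorem3:
  fixes W lam TC EC D :: real and n :: nat and w s sg :: "nat \<Rightarrow> real"
  assumes "W > 0" and "lam > 0" and "TC > 0" and "EC > 0" and "D > 0" and "n \<ge> 1"
    and "optimal W lam TC EC D n (w, s, sg)"
  shows "(\<forall>i\<in>{1..n}. w i = W / real n) \<and> (\<forall>i\<in>{1..n}. \<forall>j\<in>{1..n}. s i = s j)"
proof -
  \<comment> \<open>Exchanges need two distinct chunks; the case \<open>i = j\<close>, which is all
    there is for \<open>n = 1\<close>, is trivial.\<close>
  have eq: "s i = s j \<and> w i = w j" if "i \<in> {1..n}" "j \<in> {1..n}" for i j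
    using optimal_pair_eq[OF assms(7,2-4) that] by (cases "i = j") auto
  have "w i = W / real n" if i: "i \<in> {1..n}" for i
  proof -
    have "W = (\<Sum>k = 1..n. w k)"
      using assms(7) by (simp add: optimal_def is_arg_min_def feasible_def)
    also have "\<dots> = (\<Sum>k = 1..n. w i)" by (rule sum.cong) (use eq i in blast)+
    finally show ?thesis using \<open>n \<ge> 1\<close> by simp
  qed
  then show ?thesis using eq by blast
qed

end
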